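(* Let $S$ and $T$ be join-semilattices and let $f\colon S\to T$ be a map (morphism) of join-semilattices. Then $f$ lifts to a frame map $\mathcal{AU}(S)\to\mathcal{AU}(T)$, i.e. there exists a frame homomorphism $g\colon\mathcal{AU}(S)\to\mathcal{AU}(T)$ with $g(\uparrow x)=\uparrow f(x)$ for all $x\in S$, if and only if $f$ is admissible.
   Context: In a join-semilattice $S$, a family $\{a_i\}_{i\in I}\subseteq S$ is admissible if its meet exists in $S$ and, for each $b\in S$, the equality $b\vee\bigwedge_{i\in I} a_i=\bigwedge_{i\in I}(b\vee a_i)$ holds (in particular the right-hand meet exists). A nonempty upper set $U\subseteq S$ is admissible if it is closed under admissible meets, that is, $\bigwedge_{i\in I} a_i\in U$ for every admissible family $\{a_i\}_{i\in I}\subseteq U$. $\mathcal{AU}(S)$ denotes the collection of all admissible upper sets of $S$, ordered by inclusion; it is a frame, and the antitone embedding $\uparrow\colon S\to\mathcal{AU}(S)$, $\uparrow x=\{y\in S\mid x\le y\}$, is called the Bruns--Lakser completion of $S$. A map $f\colon S\to T$ between join-semilattices is admissible if it maps admissible families to admissible families and also preserves their meets, i.e. for every admissible family $\{a_i\}_{i\in I}\subseteq S$ the family $\{f(a_i)\}_{i\in I}$ is admissible in $T$ and $\bigwedge_{i\in I} f(a_i)=f(\bigwedge_{i\in I} a_i)$. *)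

theory Defs
  imports "HOL-Library.Lub_Glb"
begin

text \<open>
  Join-semilattices are taken with a least element, the empty join, and their morphisms
  preserve it: \<open>bot\<close> generates the top of the frame of admissible upper sets.  Without this the
  constant map from \<open>{0}\<close> to \<open>1\<close> in \<open>{0 < 1}\<close> would be an admissible morphism that does not lift.
\<close>

definition join_semilattice_hom ::
  "('a::bounded_semilattice_sup_bot \<Rightarrow> 'b::bounded_semilattice_sup_bot) \<Rightarrow> bool" where
  "join_semilattice_hom f \<longleftrightarrow> f bot = bot \<and> (\<forall>x y. f (sup x y) = sup (f x) (f y))"

text \<open>
  Only the range of a family matters for its meet, so families are represented by subsets.
  The empty family is included; it is admissible exactly if there is a greatest element.
\<close>

definition admissible_family :: "'a::bounded_semilattice_sup_bot set \<Rightarrow> bool" where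
  "admissible_family A \<longleftrightarrow>
     (\<exists>m. isGlb UNIV A m \<and> (\<forall>b. isGlb UNIV ((\<lambda>a. sup b a) ` A) (sup b m)))"

definition admissible_upset :: "'a::bounded_semilattice_sup_bot set \<Rightarrow> bool" where
  "admissible_upset U \<longleftrightarrow>
     U \<noteq> {} \<and> (\<forall>x y. x \<in> U \<longrightarrow> x \<le> y \<longrightarrow> y \<in> U) \<and>
     (\<forall>A m. A \<subseteq> U \<longrightarrow> admissible_family A \<longrightarrow> isGlb UNIV A m \<longrightarrow> m \<in> U)"

definition AU :: "'a::bounded_semilattice_sup_bot set set" where
  "AU = {U. admissible_upset U}"

definition admissible_map ::
  "('a::bounded_semilattice_sup_bot \<Rightarrow> 'b::bounded_semilattice_sup_bot) \<Rightarrow> bool" where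
  "admissible_map f \<longleftrightarrow>
     (\<forall>A m. admissible_family A \<longrightarrow> isGlb UNIV A m \<longrightarrow>
        admissible_family (f ` A) \<and> isGlb UNIV (f ` A) (f m))"

text \<open>
  Preservation of arbitrary joins and finite meets, the empty ones (bottom and top) included.
  All joins and meets are those of the ordered sets \<open>L\<close> and \<open>M\<close>, not of the ambient types.
  They all exist if \<open>L\<close> and \<open>M\<close> are frames, and then this is the usual notion of frame homomorphism.

  \<open>AU\<close> is a frame exactly if the semilattice has a greatest element; otherwise it only lacks the
  empty join, because \<open>{}\<close> is excluded, and preservation of that join imposes no condition.
\<close>

definition frame_hom :: "'a::order set \<Rightarrow> 'b::order set \<Rightarrow> ('a \<Rightarrow> 'b) \<Rightarrow> bool" where
  "frame_hom L M g \<longleftrightarrow>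
     (\<forall>x \<in> L. g x \<in> M) \<and>
     (\<forall>F j. F \<subseteq> L \<longrightarrow> isLub L F j \<longrightarrow> isLub M (g ` F) (g j)) \<and>
     (\<forall>F m. F \<subseteq> L \<longrightarrow> finite F \<longrightarrow> isGlb L F m \<longrightarrow> isGlb M (g ` F) (g m))"

end

theory Submission
  imports Defs
begin

text \<open>
  Translation by an element \<open>b\<close> is an admissible map, so \<open>{x. b \<squnion> x \<in> W}\<close> is an admissible
  upper set whenever \<open>W\<close> is.  If \<open>\<up>\<close> extends along \<open>f\<close> to a frame map, then, because \<open>\<up>\<close> turns
  admissible meets into joins, every admissible upper set containing the image of an admissible
  family contains the image of its meet; testing this on the sets \<open>{x. t \<le> b \<squnion> x}\<close> gives
  admissibility of \<open>f\<close>.  Conversely, an admissible \<open>f\<close> induces the map sending \<open>U\<close> to the admissible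
  upper set generated by \<open>f ` U\<close>; joins are preserved because preimages of admissible upper sets
  are admissible, and binary meets because \<open>f\<close> preserves joins of elements and translates of
  admissible upper sets are admissible.
\<close>

section \<open>Meets, joins and admissible families\<close>

lemma isLub_iff:
  "isLub R S x \<longleftrightarrow> x \<in> R \<and> (\<forall>s\<in>S. s \<le> x) \<and> (\<forall>y\<in>R. (\<forall>s\<in>S. s \<le> y) \<longrightarrow> x \<le> y)"
  by (auto simp: isLub_def leastP_def isUb_def setle_def setge_def)

lemma isGlb_iff:
  "isGlb R S x \<longleftrightarrow> x \<in> R \<and> (\<forall>s\<in>S. x \<le> s) \<and> (\<forall>y\<in>R. (\<forall>s\<in>S. y \<le> s) \<longrightarrow> y \<le> x)"
  by (auto simp: isGlb_def greatestP_def isLb_def setle_def setge_def)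

lemma isGlb_unique:
  fixes x y :: "'a::order"
  assumes "isGlb R S x" "isGlb R S y"
  shows "x = y"
  using assms unfolding isGlb_iff by (meson order.antisym)

lemma admissible_family_sup:
  assumes "admissible_family A" "isGlb UNIV A m"
  shows "isGlb UNIV ((\<lambda>a. sup b a) ` A) (sup b m)"
  using assms isGlb_unique unfolding admissible_family_def by metis

section \<open>Admissible upper sets and their preimages\<close>

lemma AU_upward: "U \<in> AU \<Longrightarrow> x \<in> U \<Longrightarrow> x \<le> y \<Longrightarrow> y \<in> U"
  unfolding AU_def admissible_upset_def by blast

lemma AU_nonempty: "U \<in> AU \<Longrightarrow> U \<noteq> {}"
  unfolding AU_def admissible_upset_def by blast

lemma AU_meet_closed:
  "U \<in> AU \<Longrightarrow> A \<subseteq> U \<Longrightarrow> admissible_family A \<Longrightarrow> isGlb UNIV A m \<Longrightarrow> m \<in> U"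
  unfolding AU_def admissible_upset_def by blast

lemma AU_I:
  assumes "U \<noteq> {}" "\<And>x y. x \<in> U \<Longrightarrow> x \<le> y \<Longrightarrow> y \<in> U"
    and "\<And>A m. A \<subseteq> U \<Longrightarrow> admissible_family A \<Longrightarrow> isGlb UNIV A m \<Longrightarrow> m \<in> U"
  shows "U \<in> AU"
  using assms unfolding AU_def admissible_upset_def by blast

lemma principal_in_AU: "{x..} \<in> AU"
proof (rule AU_I)
  fix A m assume "A \<subseteq> {x..}" "isGlb UNIV A m"
  then show "m \<in> {x..}" unfolding isGlb_iff by auto
qed (auto intro: order.trans)

lemma UNIV_in_AU: "UNIV \<in> AU"
  by (rule AU_I) auto

text \<open>Nonemptiness is an assumption because infinitely many members of \<open>AU\<close> can
  have empty intersection. Two members always meet: they share the join of an element of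
  each.\<close>

lemma Inter_in_AU:
  assumes "C \<subseteq> AU" "\<Inter>C \<noteq> {}"
  shows "\<Inter>C \<in> AU"
proof (rule AU_I)
  show "\<Inter>C \<noteq> {}" by fact
next
  fix x y assume "x \<in> \<Inter>C" "x \<le> y"
  then show "y \<in> \<Inter>C" using assms(1) AU_upward by blast
next
  fix A m assume "A \<subseteq> \<Inter>C" "admissible_family A" "isGlb UNIV A m"
  then show "m \<in> \<Inter>C" using assms(1) AU_meet_closed[of _ A m] by blast
qed

lemma Int_in_AU:
  assumes "U \<in> AU" "V \<in> AU"
  shows "U \<inter> V \<in> AU"
proof -
  obtain u v where "u \<in> U" "v \<in> V"
    using assms AU_nonempty by blast
  then have "sup u v \<in> U \<inter> V"
    using AU_upward[OF assms(1) _ sup_ge1] AU_upward[OF assms(2) _ sup_ge2] by blast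
  then show ?thesis
    using Inter_in_AU[of "{U, V}"] assms by auto
qed

lemma vimage_in_AU:
  assumes f: "mono f" "admissible_map f" and V: "V \<in> AU" and ne: "f -` V \<noteq> {}"
  shows "f -` V \<in> AU"
proof (rule AU_I)
  show "f -` V \<noteq> {}" by fact
next
  fix x y assume "x \<in> f -` V" "x \<le> y"
  then show "y \<in> f -` V" using AU_upward[OF V] monoD[OF f(1)] by auto
next
  fix A m assume A: "A \<subseteq> f -` V" "admissible_family A" "isGlb UNIV A m"
  then have "admissible_family (f ` A)" "isGlb UNIV (f ` A) (f m)"
    using f(2) unfolding admissible_map_def by blast+
  then show "m \<in> f -` V" using AU_meet_closed[OF V, of "f ` A"] A(1) by auto
qed

text \<open>Joining with \<open>b\<close> and then with \<open>c\<close> is joining with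
  \<open>sup c b\<close>, so admissibility of \<open>A\<close>, used at \<open>sup c b\<close>,
  covers the translated family.\<close>

lemma admissible_map_sup:
  fixes b :: "'a::bounded_semilattice_sup_bot"
  shows "admissible_map (sup b)"
  unfolding admissible_map_def
proof (intro allI impI)
  fix A and m :: 'a
  assume A: "admissible_family A" "isGlb UNIV A m"
  have "isGlb UNIV ((\<lambda>a. sup c a) ` (sup b ` A)) (sup c (sup b m))" for c
    using admissible_family_sup[OF A, of "sup c b"]
    by (simp add: image_image sup_assoc)
  then show "admissible_family (sup b ` A) \<and> isGlb UNIV (sup b ` A) (sup b m)"
    using admissible_family_sup[OF A] unfolding admissible_family_def by blast
qed

lemma sup_vimage_in_AU:
  assumes "W \<in> AU"
  shows "sup b -` W \<in> AU"
proof (rule vimage_in_AU[OF _ admissible_map_sup assms])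
  show "mono (sup b)" by (simp add: monoI sup.coboundedI2)
  show "sup b -` W \<noteq> {}"
    using AU_nonempty[OF assms] AU_upward[OF assms _ sup_ge2] by blast
qed

text \<open>A member of \<open>AU\<close> lies above all \<open>{a..}\<close> iff it contains
  \<open>A\<close>; closure under admissible meets then gives \<open>m\<close>.\<close>

lemma isLub_principal:
  assumes "admissible_family A" "isGlb UNIV A m"
  shows "isLub AU ((\<lambda>a. {a..}) ` A) {m..}"
  unfolding isLub_iff
proof (intro conjI ballI impI)
  show "{m..} \<in> AU" by (rule principal_in_AU)
next
  fix S assume "S \<in> (\<lambda>a. {a..}) ` A"
  then show "S \<subseteq> {m..}" using assms(2) unfolding isGlb_iff by auto
next
  fix V assume V: "V \<in> AU" "\<forall>S\<in>(\<lambda>a. {a..}) ` A. S \<subseteq> V"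
  then have "m \<in> V" using AU_meet_closed[OF V(1) _ assms] by fastforce
  then show "{m..} \<subseteq> V" using AU_upward[OF V(1)] by auto
qed

section \<open>From a lift to admissibility\<close>

lemma frame_hom_isLub:
  "frame_hom L M g \<Longrightarrow> F \<subseteq> L \<Longrightarrow> isLub L F j \<Longrightarrow> isLub M (g ` F) (g j)"
  by (simp add: frame_hom_def)

lemma admissible_map_if_frame_hom:
  fixes f :: "'a::bounded_semilattice_sup_bot \<Rightarrow> 'b::bounded_semilattice_sup_bot"
  assumes g: "frame_hom AU AU g" "\<And>x. g {x..} = {f x..}"
  shows "admissible_map f"
  unfolding admissible_map_def
proof (intro allI impI)
  fix A and m :: 'a
  assume A: "admissible_family A" "isGlb UNIV A m"
  have "isLub AU (g ` (\<lambda>a. {a..}) ` A) (g {m..})"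
    using isLub_principal[OF A] principal_in_AU by (intro frame_hom_isLub[OF g(1)]) auto
  then have lub: "isLub AU ((\<lambda>a. {f a..}) ` A) {f m..}"
    by (simp add: g(2) image_image)
  have le: "f m \<le> f a" if "a \<in> A" for a
    using lub that unfolding isLub_iff by auto
  \<comment> \<open>The family of all \<open>f a\<close> is not yet known to be admissible, so
    closure of \<open>V\<close> under its meet must come from the preserved join
    \<open>lub\<close>.\<close>
  have gen: "f m \<in> V" if V: "V \<in> AU" "f ` A \<subseteq> V" for V
  proof -
    have "\<forall>s\<in>(\<lambda>a. {f a..}) ` A. s \<subseteq> V"
      using V AU_upward by fastforce
    then have "{f m..} \<subseteq> V" using lub V(1) unfolding isLub_iff by blast
    then show ?thesis by auto
  qed
  have glb: "isGlb UNIV ((\<lambda>a. sup b a) ` f ` A) (sup b (f m))" for b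
    unfolding isGlb_iff
  proof (intro conjI ballI impI)
    fix s assume "s \<in> sup b ` f ` A"
    then show "sup b (f m) \<le> s" using le by (auto intro: sup.coboundedI2)
  next
    fix t assume "\<forall>s\<in>sup b ` f ` A. t \<le> s"
    \<comment> \<open>That \<open>t\<close> is a lower bound says exactly that the preimage of
      \<open>{t..}\<close> under \<open>sup b\<close> contains every \<open>f a\<close>.\<close>
    then have "f m \<in> sup b -` {t..}"
      by (intro gen sup_vimage_in_AU principal_in_AU) auto
    then show "t \<le> sup b (f m)" by simp
  qed simp
  \<comment> \<open>Joining with \<open>bot\<close> is the identity.\<close>
  from glb[of bot] have "isGlb UNIV (f ` A) (f m)" by simp
  with glb show "admissible_family (f ` A) \<and> isGlb UNIV (f ` A) (f m)"
    unfolding admissible_family_def by blast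
qed

section \<open>The lift induced by an admissible map\<close>

definition AU_hull :: "'a::bounded_semilattice_sup_bot set \<Rightarrow> 'a set" where
  "AU_hull X = \<Inter>{V \<in> AU. X \<subseteq> V}"

lemma subset_AU_hull: "X \<subseteq> AU_hull X"
  unfolding AU_hull_def by blast

lemma AU_hull_least: "V \<in> AU \<Longrightarrow> X \<subseteq> V \<Longrightarrow> AU_hull X \<subseteq> V"
  unfolding AU_hull_def by blast

text \<open>\<open>AU_hull {}\<close> is empty unless there is a greatest element.\<close>

lemma AU_hull_in_AU:
  assumes "X \<noteq> {}"
  shows "AU_hull X \<in> AU"
  unfolding AU_hull_def
  using assms subset_AU_hull[of X] by (intro Inter_in_AU) (auto simp: AU_hull_def)

lemma AU_hull_mono: "X \<subseteq> Y \<Longrightarrow> AU_hull X \<subseteq> AU_hull Y"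
  unfolding AU_hull_def by blast

text \<open>The condition \<open>sup x y \<in> W\<close> passes from generators to hulls one
  variable at a time, since translates of \<open>W\<close> stay in \<open>AU\<close>. Finally both
  variables are set to \<open>z\<close>, and \<open>sup z z = z\<close>.\<close>

lemma AU_hull_Int_subset:
  assumes W: "W \<in> AU" and sup: "\<And>x y. x \<in> X \<Longrightarrow> y \<in> Y \<Longrightarrow> sup x y \<in> W"
  shows "AU_hull X \<inter> AU_hull Y \<subseteq> W"
proof
  fix z assume z: "z \<in> AU_hull X \<inter> AU_hull Y"
  have "AU_hull Y \<subseteq> sup x -` W" if "x \<in> X" for x
    using that assms(2) by (intro AU_hull_least sup_vimage_in_AU W) auto
  then have "sup x z \<in> W" if "x \<in> X" for x using that z by blast
  then have "X \<subseteq> sup z -` W" by (auto simp: sup_commute)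
  then have "AU_hull X \<subseteq> sup z -` W"
    by (intro AU_hull_least sup_vimage_in_AU W)
  then show "z \<in> W" using z by auto
qed

lemma mono_if_sup:
  fixes f :: "'a::semilattice_sup \<Rightarrow> 'b::semilattice_sup"
  assumes "\<And>x y. f (sup x y) = sup (f x) (f y)"
  shows "mono f"
proof (rule monoI)
  fix x y :: 'a assume "x \<le> y"
  then have "f y = sup (f x) (f y)" using assms[of x y] by (simp add: sup_absorb2)
  then show "f x \<le> f y" by (metis sup_ge1)
qed

lemma AU_hull_image_principal:
  assumes "mono f"
  shows "AU_hull (f ` {x..}) = {f x..}"
proof
  show "AU_hull (f ` {x..}) \<subseteq> {f x..}"
    using assms by (intro AU_hull_least principal_in_AU) (auto dest: monoD)
  have "f x \<in> AU_hull (f ` {x..})" using subset_AU_hull by fastforce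
  then show "{f x..} \<subseteq> AU_hull (f ` {x..})"
    using AU_upward[OF AU_hull_in_AU[of "f ` {x..}"]] by blast
qed

lemma AU_hull_image_Int:
  assumes f: "\<And>x y. f (sup x y) = sup (f x) (f y)" and U: "U \<in> AU" and V: "V \<in> AU"
  shows "AU_hull (f ` (U \<inter> V)) = AU_hull (f ` U) \<inter> AU_hull (f ` V)"
proof
  show "AU_hull (f ` (U \<inter> V)) \<subseteq> AU_hull (f ` U) \<inter> AU_hull (f ` V)"
    by (simp add: AU_hull_mono image_mono)
  show "AU_hull (f ` U) \<inter> AU_hull (f ` V) \<subseteq> AU_hull (f ` (U \<inter> V))"
  proof (rule AU_hull_Int_subset)
    show "AU_hull (f ` (U \<inter> V)) \<in> AU"
      using AU_nonempty[OF Int_in_AU[OF U V]] by (intro AU_hull_in_AU) simp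
    fix x y assume "x \<in> f ` U" "y \<in> f ` V"
    then obtain u v where uv: "u \<in> U" "v \<in> V" "x = f u" "y = f v" by blast
    then have "sup u v \<in> U \<inter> V"
      using AU_upward[OF U _ sup_ge1] AU_upward[OF V _ sup_ge2] by blast
    then have "f (sup u v) \<in> AU_hull (f ` (U \<inter> V))"
      using subset_AU_hull[of "f ` (U \<inter> V)"] by blast
    then show "sup x y \<in> AU_hull (f ` (U \<inter> V))"
      using uv f by simp
  qed
qed

text \<open>The empty meet is \<open>UNIV\<close>, generated by \<open>bot\<close>, so that case
  rests on \<open>f bot = bot\<close>. Membership in \<open>AU\<close> is carried along because the
  binary case needs it in the induction step.\<close>

lemma AU_hull_image_Inter:
  assumes bot: "f bot = bot" and sup: "\<And>x y. f (sup x y) = sup (f x) (f y)"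
    and "finite F" "F \<subseteq> AU"
  shows "\<Inter>F \<in> AU \<and> AU_hull (f ` \<Inter>F) = (\<Inter>U\<in>F. AU_hull (f ` U))"
  using assms(3,4)
proof (induction F rule: finite_induct)
  case empty
  have "f bot \<in> AU_hull (range f)" using subset_AU_hull rangeI by (rule subsetD)
  then have "bot \<in> AU_hull (range f)" by (simp only: bot)
  then have "AU_hull (range f) = UNIV"
    using AU_upward[OF AU_hull_in_AU _ bot_least] by blast
  then show ?case using UNIV_in_AU by simp
next
  case (insert U F)
  then show ?case by (simp add: AU_hull_image_Int[OF sup] Int_in_AU)
qed

lemma frame_hom_AU_hull_image:
  fixes f :: "'a::bounded_semilattice_sup_bot \<Rightarrow> 'b::bounded_semilattice_sup_bot"
  assumes bot: "f bot = bot" and sup: "\<And>x y. f (sup x y) = sup (f x) (f y)"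
    and f: "admissible_map f"
  shows "frame_hom (AU :: 'a set set) (AU :: 'b set set) (\<lambda>U. AU_hull (f ` U))"
  unfolding frame_hom_def
proof (intro conjI ballI allI impI)
  have "mono f" using sup by (rule mono_if_sup)
  show closed: "AU_hull (f ` U) \<in> AU" if "U \<in> AU" for U
    using AU_nonempty[OF that] by (simp add: AU_hull_in_AU)
  show "isLub AU ((\<lambda>U. AU_hull (f ` U)) ` F) (AU_hull (f ` j))"
    if F: "F \<subseteq> AU" and j: "isLub AU F j" for F j
    unfolding isLub_iff
  proof (intro conjI ballI impI)
    show "AU_hull (f ` j) \<in> AU" using closed j unfolding isLub_iff by blast
  next
    fix S assume "S \<in> (\<lambda>U. AU_hull (f ` U)) ` F"
    then obtain U where "U \<subseteq> j" "S = AU_hull (f ` U)" using j unfolding isLub_iff by blast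
    then show "S \<subseteq> AU_hull (f ` j)" by (simp add: AU_hull_mono image_mono)
  next
    fix V assume V: "V \<in> AU" "\<forall>S\<in>(\<lambda>U. AU_hull (f ` U)) ` F. S \<subseteq> V"
    then have sub: "U \<subseteq> f -` V" if "U \<in> F" for U
      using that V(2) subset_AU_hull[of "f ` U"] by blast
    \<comment> \<open>Subsets of the preimage supply a point when \<open>F\<close> has a member;
      otherwise \<open>V\<close> must be shown to meet the range of \<open>f\<close>.\<close>
    have "f -` V \<noteq> {}"
    proof (cases "F = {}")
      case False
      then show ?thesis using sub F AU_nonempty by blast
    next
      case True
      \<comment> \<open>The empty join exists only if there is a greatest element \<open>u\<close>.
        Then \<open>{}\<close> is admissible with meet \<open>u\<close>, so \<open>f u\<close> is the greatest element of the codomain.\<close>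
      with j have "j \<in> AU" and least: "\<And>U. U \<in> AU \<Longrightarrow> j \<subseteq> U" unfolding isLub_iff by auto
      then obtain u where u: "u \<in> j" using AU_nonempty by blast
      then have top: "x \<le> u" for x using least[OF principal_in_AU, of x] by auto
      then have glb: "isGlb UNIV {} u" unfolding isGlb_iff by auto
      have "sup b u = u" for b using top by (rule sup_absorb2)
      then have "admissible_family ({} :: 'a set)"
        unfolding admissible_family_def using glb by auto
      then have "isGlb UNIV (f ` {}) (f u)" using f glb unfolding admissible_map_def by blast
      then have "y \<le> f u" for y unfolding isGlb_iff by auto
      then show ?thesis using AU_nonempty[OF V(1)] AU_upward[OF V(1)] by blast
    qed
    \<comment> \<open>Hull of the image is left adjoint to preimage: the preimage of
      \<open>V\<close> is an upper bound of \<open>F\<close> in \<open>AU\<close>, hence contains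
      the join \<open>j\<close>.\<close>
    then have "f -` V \<in> AU" using vimage_in_AU \<open>mono f\<close> f V(1) by blast
    then have "j \<subseteq> f -` V" using j sub unfolding isLub_iff by blast
    then show "AU_hull (f ` j) \<subseteq> V" using V(1) by (intro AU_hull_least) auto
  qed
  show "isGlb AU ((\<lambda>U. AU_hull (f ` U)) ` F) (AU_hull (f ` m))"
    if F: "F \<subseteq> AU" "finite F" and m: "isGlb AU F m" for F m
  proof -
    have Inter: "\<Inter>F \<in> AU" "AU_hull (f ` \<Inter>F) = (\<Inter>U\<in>F. AU_hull (f ` U))"
      using AU_hull_image_Inter[OF bot sup F(2,1)] by blast+
    have "isGlb AU F (\<Inter>F)" using Inter(1) unfolding isGlb_iff by blast
    then have "m = \<Inter>F" using m isGlb_unique by blast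
    then show ?thesis using closed[OF Inter(1)] Inter(2) unfolding isGlb_iff by auto
  qed
qed

theorem theorem6p3:
  fixes f :: "'a::bounded_semilattice_sup_bot \<Rightarrow> 'b::bounded_semilattice_sup_bot"
  assumes "join_semilattice_hom f"
  shows "(\<exists>g. frame_hom (AU :: 'a set set) (AU :: 'b set set) g \<and> (\<forall>x. g {x..} = {f x..}))
         \<longleftrightarrow> admissible_map f"
proof
  assume "\<exists>g. frame_hom (AU :: 'a set set) (AU :: 'b set set) g \<and> (\<forall>x. g {x..} = {f x..})"
  then show "admissible_map f" using admissible_map_if_frame_hom by blast
next
  assume "admissible_map f"
  moreover have bot: "f bot = bot" and sup: "f (sup x y) = sup (f x) (f y)" for x y
    using assms unfolding join_semilattice_hom_def by blast+
  moreover have "mono f" using sup by (rule mono_if_sup)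
  ultimately show "\<exists>g. frame_hom (AU :: 'a set set) (AU :: 'b set set) g \<and> (\<forall>x. g {x..} = {f x..})"
    using frame_hom_AU_hull_image AU_hull_image_principal by blast
qed

end
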